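(* Let $p$ and $c$ be integers with $p \geq 1$ and $c \geq 3$. Let $G=(V,E)$ be a $1$-FT($pK_c$) graph with $|V|=pc+1$. If $|E| \leq \binom{c+1}{2} p$, then every block of $G$ is isomorphic to $K_{c+1}$.
   Context: All graphs are finite, simple and undirected. For integers $k\ge 0$, $p\ge 1$, $c\ge 2$, a graph $G=(V,E)$ is called $k$-FT($pK_c$) if for every $S\subset V$ with $|S|\le k$, the graph $G-S$ contains as a subgraph the disjoint union of $p$ complete graphs $K_c$. A block of a graph is a maximal connected subgraph without a cutvertex. *)

theory Defs
  imports Main
begin

datatype 'a graph = Graph (verts: "'a set") (edges: "'a set set")

definition two_subsets :: "'a set \<Rightarrow> 'a set set" where
  "two_subsets A = {e. e \<subseteq> A \<and> card e = 2}"

definition simple_graph :: "'a graph \<Rightarrow> bool" where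
  "simple_graph G \<longleftrightarrow> finite (verts G) \<and> edges G \<subseteq> two_subsets (verts G)"

definition subgraph :: "'a graph \<Rightarrow> 'a graph \<Rightarrow> bool" where
  "subgraph H G \<longleftrightarrow> simple_graph H \<and> verts H \<subseteq> verts G \<and> edges H \<subseteq> edges G"

definition delete_verts :: "'a graph \<Rightarrow> 'a set \<Rightarrow> 'a graph" where
  "delete_verts G S = Graph (verts G - S) {e \<in> edges G. e \<inter> S = {}}"

definition graph_iso :: "'a graph \<Rightarrow> 'b graph \<Rightarrow> bool" where
  "graph_iso G H \<longleftrightarrow> (\<exists>f. bij_betw f (verts G) (verts H) \<and>
     (\<forall>u\<in>verts G. \<forall>v\<in>verts G. {u, v} \<in> edges G \<longleftrightarrow> {f u, f v} \<in> edges H))"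

definition contains_subgraph :: "'a graph \<Rightarrow> 'b graph \<Rightarrow> bool" where
  "contains_subgraph G H \<longleftrightarrow> (\<exists>H'. subgraph H' G \<and> graph_iso H' H)"

definition complete_graph :: "nat \<Rightarrow> nat graph" where
  "complete_graph n = Graph {..<n} (two_subsets {..<n})"

text \<open>The disjoint union of \<open>p\<close> copies of \<open>complete_graph c\<close>; the first component of a
  vertex is the index of its copy.\<close>

definition copies_complete :: "nat \<Rightarrow> nat \<Rightarrow> (nat \<times> nat) graph" where
  "copies_complete p c = Graph ({..<p} \<times> {..<c}) (\<Union>i<p. two_subsets ({i} \<times> {..<c}))"

definition fault_tolerant :: "nat \<Rightarrow> nat \<Rightarrow> nat \<Rightarrow> 'a graph \<Rightarrow> bool" where
  "fault_tolerant k p c G \<longleftrightarrow> (\<forall>S. S \<subseteq> verts G \<and> card S \<le> k \<longrightarrow>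
     contains_subgraph (delete_verts G S) (copies_complete p c))"

definition reachable :: "'a graph \<Rightarrow> 'a \<Rightarrow> 'a \<Rightarrow> bool" where
  "reachable G = (\<lambda>u v. {u, v} \<in> edges G)\<^sup>*\<^sup>*"

definition components :: "'a graph \<Rightarrow> 'a set set" where
  "components G = {{v \<in> verts G. reachable G u v} | u. u \<in> verts G}"

definition connected_graph :: "'a graph \<Rightarrow> bool" where
  "connected_graph G \<longleftrightarrow> verts G \<noteq> {} \<and> (\<forall>u\<in>verts G. \<forall>v\<in>verts G. reachable G u v)"

text \<open>Counting components, rather than asking that the remaining graph be not connected,
  ensures that the vertex of a one-vertex graph is not a cutvertex.\<close>

definition cutvertex :: "'a graph \<Rightarrow> 'a \<Rightarrow> bool" where
  "cutvertex G v \<longleftrightarrow> v \<in> verts G \<and>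
     card (components (delete_verts G {v})) > card (components G)"

definition nonseparable_subgraph :: "'a graph \<Rightarrow> 'a graph \<Rightarrow> bool" where
  "nonseparable_subgraph B G \<longleftrightarrow> subgraph B G \<and> connected_graph B \<and> (\<nexists>v. cutvertex B v)"

definition block :: "'a graph \<Rightarrow> 'a graph \<Rightarrow> bool" where
  "block B G \<longleftrightarrow> nonseparable_subgraph B G \<and>
     (\<forall>B'. nonseparable_subgraph B' G \<and> subgraph B B' \<longrightarrow> B' = B)"

end

theory Submission
  imports Defs
begin

text \<open>
  Every vertex has degree at least \<open>c\<close>, and since \<open>c \<ge> 3\<close> a vertex of degree exactly \<open>c\<close>
  has a closed neighbourhood \<open>K\<close> that is a clique; by averaging, such a vertex \<open>v\<close> exists.
  Contracting \<open>K\<close> to \<open>v\<close> yields a graph satisfying the hypotheses for \<open>p - 1\<close>.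
  By induction it has exactly \<open>(p - 1) * ((c + 1) choose 2)\<close> edges, hence the contraction
  merges no two edges outside \<open>K\<close>, and it has a pendant \<open>(c + 1)\<close>-clique, attached to the
  rest at a single vertex and avoiding \<open>v\<close> except possibly as the attaching vertex.
  Fault tolerance lifts this clique to a pendant clique of the original graph.
  Removing pendant cliques one at a time, each of them being a block, gives the theorem.
\<close>

section \<open>Clique factors, tight graphs and pendant cliques\<close>

text \<open>A spanning \<open>pK_c\<close> on \<open>W\<close>, given by the vertex sets of its
  copies. The number of copies is not recorded, since for finite \<open>W\<close> and positive
  \<open>c\<close> it is determined by \<open>card W\<close>.\<close>

definition clique_factor :: "nat \<Rightarrow> 'a set set \<Rightarrow> 'a set set \<Rightarrow> 'a set \<Rightarrow> bool" where
  "clique_factor c E F W \<longleftrightarrow> \<Union>F = W \<and> pairwise disjnt F \<and>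
     (\<forall>A\<in>F. card A = c \<and> two_subsets A \<subseteq> E)"

definition tight_graph :: "nat \<Rightarrow> nat \<Rightarrow> 'a set \<Rightarrow> 'a set set \<Rightarrow> bool" where
  "tight_graph c p V E \<longleftrightarrow> finite V \<and> E \<subseteq> two_subsets V \<and> card V = p * c + 1 \<and>
     card E \<le> ((c + 1) choose 2) * p \<and> (\<forall>w\<in>V. \<exists>F. clique_factor c E F (V - {w}))"

text \<open>The \<open>(c + 1)\<close>-clique is \<open>insert x L\<close>. The attaching vertex
  \<open>x\<close> is kept apart because removing the clique deletes \<open>L\<close> only.\<close>

definition pendant_clique :: "nat \<Rightarrow> 'a set \<Rightarrow> 'a set set \<Rightarrow> 'a set \<Rightarrow> 'a \<Rightarrow> bool" where
  "pendant_clique c V E L x \<longleftrightarrow> L \<subseteq> V \<and> x \<in> V \<and> x \<notin> L \<and> card L = c \<and>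
     two_subsets (insert x L) \<subseteq> E \<and> (\<forall>e\<in>E. e \<inter> L \<noteq> {} \<longrightarrow> e \<subseteq> insert x L)"

section \<open>Elementary facts on edges and clique factors\<close>

lemma two_subsets_pair: "{a, b} \<in> two_subsets A \<longleftrightarrow> a \<in> A \<and> b \<in> A \<and> a \<noteq> b"
  by (auto simp: two_subsets_def card_insert_if)

lemma two_subsetsE:
  assumes "e \<in> two_subsets A"
  obtains a b where "e = {a, b}" "a \<noteq> b" "a \<in> A" "b \<in> A"
  using assms by (auto simp: two_subsets_def card_2_iff)

lemma two_subsets_mono: "A \<subseteq> B \<Longrightarrow> two_subsets A \<subseteq> two_subsets B"
  by (auto simp: two_subsets_def)

lemma clique_edge:
  assumes "two_subsets A \<subseteq> E" "a \<in> A" "b \<in> A" "a \<noteq> b"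
  shows "{a, b} \<in> E"
  using assms two_subsets_pair[of a b A] by blast

lemma edge_verts:
  assumes "E \<subseteq> two_subsets V" "{a, b} \<in> E"
  shows "a \<in> V" "b \<in> V" "a \<noteq> b"
  using assms two_subsets_pair[of a b V] by blast+

lemma finite_two_subsets: "finite A \<Longrightarrow> finite (two_subsets A)"
  by (auto simp: two_subsets_def intro: finite_subset[of _ "Pow A"])

lemma card_two_subsets: "finite A \<Longrightarrow> card (two_subsets A) = card A choose 2"
  unfolding two_subsets_def by (rule n_subsets)

lemma clique_factor_cover:
  assumes "clique_factor c E F W" "v \<in> W"
  obtains A where "A \<in> F" "v \<in> A" "A \<subseteq> W" "card A = c" "two_subsets A \<subseteq> E"
  using assms unfolding clique_factor_def by blast

lemma clique_factor_disjoint: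
  assumes "clique_factor c E F W" "A \<in> F" "B \<in> F" "A \<noteq> B"
  shows "A \<inter> B = {}"
  using assms unfolding clique_factor_def pairwise_def disjnt_def by blast

lemma clique_factor_remove:
  assumes "clique_factor c E F W" "A \<in> F"
  shows "clique_factor c E (F - {A}) (W - A)"
proof -
  have "\<Union>(F - {A}) = W - A"
    using assms clique_factor_disjoint[OF assms(1) assms(2)]
    unfolding clique_factor_def by fastforce
  thus ?thesis using assms unfolding clique_factor_def by (auto simp: pairwise_def)
qed

text \<open>Meant for the contraction map: injectivity and preservation of edges are required only
  on the vertices that the factor covers.\<close>

lemma clique_factor_image:
  assumes F: "clique_factor c E F W" and inj: "inj_on f W"
    and E': "\<And>a b. {a, b} \<in> E \<Longrightarrow> a \<in> W \<Longrightarrow> b \<in> W \<Longrightarrow> a \<noteq> b \<Longrightarrow> {f a, f b} \<in> E'"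
  shows "clique_factor c E' ((`) f ` F) (f ` W)"
proof -
  have sub: "A \<subseteq> W" if "A \<in> F" for A using F that unfolding clique_factor_def by blast
  have "\<Union>((`) f ` F) = f ` W" using F unfolding clique_factor_def by blast
  moreover have "pairwise disjnt ((`) f ` F)"
  proof (rule pairwiseI)
    fix X Y assume "X \<in> (`) f ` F" "Y \<in> (`) f ` F" "X \<noteq> Y"
    then obtain A B where AB: "A \<in> F" "B \<in> F" "X = f ` A" "Y = f ` B" "A \<noteq> B" by blast
    have "f ` A \<inter> f ` B = f ` (A \<inter> B)"
      using inj_on_image_Int[OF inj sub sub] AB by metis
    thus "disjnt X Y" using clique_factor_disjoint[OF F] AB by (auto simp: disjnt_def)
  qed
  moreover have "card (f ` A) = c \<and> two_subsets (f ` A) \<subseteq> E'" if A: "A \<in> F" for A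
  proof
    have Ac: "card A = c" "two_subsets A \<subseteq> E" using F A unfolding clique_factor_def by auto
    show "card (f ` A) = c"
      using card_image[OF inj_on_subset[OF inj sub[OF A]]] Ac by simp
    show "two_subsets (f ` A) \<subseteq> E'"
    proof
      fix e assume "e \<in> two_subsets (f ` A)"
      then obtain a b where ab: "e = {f a, f b}" "f a \<noteq> f b" "a \<in> A" "b \<in> A"
        by (blast elim: two_subsetsE)
      hence "{a, b} \<in> E" using clique_edge[OF Ac(2)] by blast
      thus "e \<in> E'" using E' ab sub[OF A] by blast
    qed
  qed
  ultimately show ?thesis unfolding clique_factor_def by blast
qed

lemma clique_subset_closed:
  assumes "two_subsets A \<subseteq> E" "v \<in> A" "\<And>u. {v, u} \<in> E \<Longrightarrow> u \<in> K" "v \<in> K"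
  shows "A \<subseteq> K"
proof
  fix u assume "u \<in> A"
  show "u \<in> K"
  proof (cases "u = v")
    case False
    hence "{v, u} \<in> E" using clique_edge[OF assms(1,2)] \<open>u \<in> A\<close> by blast
    thus ?thesis using assms(3) by blast
  qed (use assms in simp)
qed

section \<open>Degrees and vertices with a clique neighbourhood\<close>

lemma card_pos_obtain:
  assumes "card A \<ge> 1" obtains a where "a \<in> A"
  using assms by (metis card.empty ex_in_conv not_one_le_zero)

text \<open>A clique of a factor through \<open>v\<close> gives some neighbour \<open>u\<close>.
  After deleting \<open>u\<close>, the clique through \<open>v\<close> gives \<open>c - 1\<close>
  neighbours other than \<open>u\<close>, and \<open>u\<close> itself is one more.\<close>

lemma min_degree:
  assumes "finite V" "E \<subseteq> two_subsets V" "\<forall>w\<in>V. \<exists>F. clique_factor c E F (V - {w})"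
    and "c \<ge> 2" "card V \<ge> 2" "v \<in> V"
  shows "card {u. {v, u} \<in> E} \<ge> c"
proof -
  let ?N = "{u. {v, u} \<in> E}"
  have NV: "?N \<subseteq> V - {v}" using edge_verts[OF assms(2)] by blast
  hence finN: "finite ?N" using assms(1) finite_subset by blast
  have nbr: "\<exists>A. v \<in> A \<and> w \<notin> A \<and> card A = c \<and> A - {v} \<subseteq> ?N" if w: "w \<in> V" "w \<noteq> v" for w
  proof -
    obtain F where F: "clique_factor c E F (V - {w})" using assms(3) w by blast
    have "v \<in> V - {w}" using w assms(6) by blast
    then obtain A where A: "A \<in> F" "v \<in> A" "A \<subseteq> V - {w}" "card A = c" "two_subsets A \<subseteq> E"
      by (rule clique_factor_cover[OF F])
    have "A - {v} \<subseteq> ?N" using A clique_edge[OF A(5)] by blast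
    thus ?thesis using A by blast
  qed
  have "card (V - {v}) \<ge> 1" using assms by simp
  then obtain w where "w \<in> V - {v}" by (rule card_pos_obtain)
  then obtain A where A: "v \<in> A" "card A = c" "A - {v} \<subseteq> ?N" using nbr[of w] by blast
  have "card (A - {v}) \<ge> 1" using A assms(4) by simp
  then obtain u where u: "u \<in> A - {v}" by (rule card_pos_obtain)
  hence uN: "u \<in> ?N" using A by blast
  then obtain A' where A': "v \<in> A'" "u \<notin> A'" "card A' = c" "A' - {v} \<subseteq> ?N" using nbr[of u] NV by blast
  have "card (insert u (A' - {v})) \<le> card ?N" using A' uN by (intro card_mono[OF finN]) auto
  moreover have "finite A'" using A' assms(4) by (intro card_ge_0_finite) simp
  ultimately show ?thesis using A' assms(4) by simp
qed

text \<open>Given neighbours \<open>x\<close> and \<open>y\<close>, delete a third neighbour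
  \<open>u\<close>, which exists as \<open>c \<ge> 3\<close>. Only \<open>c - 1\<close> neighbours
  of \<open>v\<close> are left, so the clique covering \<open>v\<close> uses all of them,
  \<open>x\<close> and \<open>y\<close> included.\<close>

lemma min_degree_closed_nbhd_clique:
  assumes "finite V" "E \<subseteq> two_subsets V" "\<forall>w\<in>V. \<exists>F. clique_factor c E F (V - {w})"
    and "c \<ge> 3" "v \<in> V" and deg: "card {u. {v, u} \<in> E} = c"
  shows "two_subsets (insert v {u. {v, u} \<in> E}) \<subseteq> E"
proof
  let ?N = "{u. {v, u} \<in> E}"
  have NV: "?N \<subseteq> V - {v}" using edge_verts[OF assms(2)] by blast
  hence finN: "finite ?N" using assms(1) finite_subset by blast
  have adj: "{x, y} \<in> E" if xy: "x \<in> ?N" "y \<in> ?N" "x \<noteq> y" for x y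
  proof -
    have "card (?N - {x, y}) \<ge> 1" using xy deg assms(4) by (simp add: card_Diff_subset)
    then obtain u where u: "u \<in> ?N - {x, y}" by (rule card_pos_obtain)
    then obtain F where F: "clique_factor c E F (V - {u})" using assms(3) NV by blast
    have "v \<in> V - {u}" using u NV assms(5) by blast
    then obtain A where A: "v \<in> A" "A \<subseteq> V - {u}" "card A = c" "two_subsets A \<subseteq> E"
      by (rule clique_factor_cover[OF F])
    have "A - {v} \<subseteq> ?N - {u}" using A clique_edge[OF A(4)] by blast
    \<comment> \<open>Both sets have \<open>c - 1\<close> elements, which turns the inclusion into
      an equality.\<close>
    moreover have "card (A - {v}) = card (?N - {u})" using A u deg by simp
    ultimately have "A - {v} = ?N - {u}" using finN by (intro card_subset_eq) auto
    thus ?thesis using clique_edge[OF A(4)] xy u by blast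
  qed
  fix e assume "e \<in> two_subsets (insert v ?N)"
  then obtain a b where ab: "e = {a, b}" "a \<noteq> b" "a \<in> insert v ?N" "b \<in> insert v ?N"
    by (rule two_subsetsE)
  show "e \<in> E"
  proof (cases "a = v \<or> b = v")
    case True
    hence "e = {v, b} \<and> b \<in> ?N \<or> e = {v, a} \<and> a \<in> ?N" using ab by blast
    thus ?thesis by blast
  next
    case False
    thus ?thesis using ab adj[of a b] by blast
  qed
qed

lemma sum_degrees:
  assumes "finite V" "E \<subseteq> two_subsets V"
  shows "(\<Sum>v\<in>V. card {u. {v, u} \<in> E}) = 2 * card E"
proof -
  have "card {u. {v, u} \<in> E} = card {e\<in>E. v \<in> e}" for v
  proof (rule bij_betw_same_card)
    show "bij_betw (\<lambda>u. {v, u}) {u. {v, u} \<in> E} {e\<in>E. v \<in> e}"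
      unfolding bij_betw_def
    proof
      show "inj_on (\<lambda>u. {v, u}) {u. {v, u} \<in> E}" by (auto simp: inj_on_def doubleton_eq_iff)
      have "e \<in> (\<lambda>u. {v, u}) ` {u. {v, u} \<in> E}" if e: "e \<in> E" "v \<in> e" for e
      proof -
        obtain a b where "e = {a, b}" using e assms(2) by (blast elim: two_subsetsE)
        hence "e = {v, a} \<or> e = {v, b}" using e by auto
        thus ?thesis using e by blast
      qed
      thus "(\<lambda>u. {v, u}) ` {u. {v, u} \<in> E} = {e\<in>E. v \<in> e}" by blast
    qed
  qed
  moreover have "(\<Sum>v\<in>V. card {e\<in>E. v \<in> e}) = 2 * card E"
  proof (rule sum_multicount)
    show "finite E" using assms finite_two_subsets finite_subset by metis
    show "\<forall>e\<in>E. card {v \<in> V. v \<in> e} = 2"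
    proof
      fix e assume "e \<in> E"
      hence "e \<subseteq> V" "card e = 2" using assms(2) by (auto simp: two_subsets_def)
      moreover from this have "{v \<in> V. v \<in> e} = e" by blast
      ultimately show "card {v \<in> V. v \<in> e} = 2" by simp
    qed
  qed (rule assms)
  ultimately show ?thesis by simp
qed

text \<open>The average degree is at most \<open>c * (c + 1) * p / (p * c + 1)\<close>, which is
  less than \<open>c + 1\<close>. So some vertex has degree at most \<open>c\<close>, hence exactly
  \<open>c\<close> by \<open>min_degree\<close>, and \<open>K\<close> is its closed
  neighbourhood.\<close>

lemma ex_simplicial_clique:
  assumes T: "tight_graph c p V E" and "c \<ge> 3" "p \<ge> 1"
  obtains v K where "v \<in> K" "K \<subseteq> V" "card K = c + 1" "two_subsets K \<subseteq> E"
    "\<And>u. {v, u} \<in> E \<Longrightarrow> u \<in> K"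
proof -
  have T': "finite V" "E \<subseteq> two_subsets V" "card V = p * c + 1"
     "card E \<le> ((c + 1) choose 2) * p" "\<forall>w\<in>V. \<exists>F. clique_factor c E F (V - {w})"
    using T by (auto simp: tight_graph_def)
  have "card V \<ge> 2" using T'(3) assms(2,3) by (cases p) auto
  have "\<exists>v\<in>V. card {u. {v, u} \<in> E} \<le> c"
  proof (rule ccontr)
    assume "\<not> ?thesis"
    hence "\<And>v. v \<in> V \<Longrightarrow> c + 1 \<le> card {u. {v, u} \<in> E}" by fastforce
    hence "card V * (c + 1) \<le> (\<Sum>v\<in>V. card {u. {v, u} \<in> E})"
      using sum_bounded_below[of V "c + 1" "\<lambda>v. card {u. {v, u} \<in> E}"] by simp
    also have "\<dots> = 2 * card E" using sum_degrees T' by blast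
    also have "\<dots> \<le> 2 * ((c + 1) choose 2) * p" using T'(4) by simp
    also have "2 * ((c + 1) choose 2) = (c + 1) * c" by (simp add: choose_two)
    finally have "(p * c + 1) * (c + 1) \<le> (c + 1) * c * p" using T'(3) by simp
    \<comment> \<open>The left side exceeds the right side by \<open>c + 1\<close>.\<close>
    thus False by (simp add: algebra_simps)
  qed
  then obtain v where v: "v \<in> V" "card {u. {v, u} \<in> E} \<le> c" by blast
  hence deg: "card {u. {v, u} \<in> E} = c"
    using min_degree[OF T'(1,2,5) _ \<open>card V \<ge> 2\<close>] assms(2) by fastforce
  have N: "{u. {v, u} \<in> E} \<subseteq> V - {v}" using edge_verts[OF T'(2)] by blast
  show thesis
  proof (rule that[of v "insert v {u. {v, u} \<in> E}"])
    have "finite {u. {v, u} \<in> E}" using N T'(1) finite_subset by blast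
    moreover have "v \<notin> {u. {v, u} \<in> E}" using N by blast
    ultimately show "card (insert v {u. {v, u} \<in> E}) = c + 1" using deg by simp
    show "two_subsets (insert v {u. {v, u} \<in> E}) \<subseteq> E"
      using min_degree_closed_nbhd_clique[OF T'(1,2,5) assms(2) v(1) deg] .
  qed (use N v in auto)
qed

text \<open>The clique that covers \<open>v\<close> has \<open>c\<close> vertices and stays inside
  \<open>K\<close>, which has \<open>c + 1\<close>, so it misses exactly one vertex \<open>b\<close>
  of \<open>K\<close>.\<close>

lemma factor_at_simplicial:
  assumes F: "clique_factor c E F (V - {w})" and v: "v \<in> K" "v \<in> V" "v \<noteq> w" "finite K" "card K = c + 1"
    and cl: "\<And>u. {v, u} \<in> E \<Longrightarrow> u \<in> K"
  obtains A b where "A \<in> F" "b \<in> K" "A = K - {b}"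
proof -
  have "v \<in> V - {w}" using v by blast
  then obtain A where A: "A \<in> F" "v \<in> A" "A \<subseteq> V - {w}" "card A = c" "two_subsets A \<subseteq> E"
    by (rule clique_factor_cover[OF F])
  have AK: "A \<subseteq> K" using clique_subset_closed[OF A(5,2) cl v(1)] .
  hence "card (K - A) = 1" using A v by (simp add: card_Diff_subset finite_subset)
  then obtain b where "K - A = {b}" by (auto simp: card_1_singleton_iff)
  hence "A = K - {b}" "b \<in> K" using AK by blast+
  thus thesis using that A(1) by blast
qed

section \<open>Contracting the clique and lifting pendant cliques back\<close>

definition contract_map :: "'a set \<Rightarrow> 'a \<Rightarrow> 'a \<Rightarrow> 'a" where
  "contract_map K v x = (if x \<in> K then v else x)"

text \<open>Edges inside \<open>K\<close> are dropped, as they would collapse to singletons. Since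
  the result is a set, edges that become parallel are merged, so the edge count may drop
  further.\<close>

definition contract_edges :: "'a set \<Rightarrow> 'a \<Rightarrow> 'a set set \<Rightarrow> 'a set set" where
  "contract_edges K v E = (`) (contract_map K v) ` (E - two_subsets K)"

lemma contract_edges_pair:
  assumes "{a, b} \<in> E" "\<not> (a \<in> K \<and> b \<in> K)"
  shows "{contract_map K v a, contract_map K v b} \<in> contract_edges K v E"
proof -
  have "{a, b} \<in> E - two_subsets K" using assms by (auto simp: two_subsets_pair)
  hence "contract_map K v ` {a, b} \<in> contract_edges K v E" unfolding contract_edges_def by blast
  thus ?thesis by simp
qed

text \<open>The contraction fixes every edge that misses \<open>K\<close>, while the image of any
  other edge contains \<open>v\<close>.\<close>

lemma contract_edges_avoiding:
  assumes "e \<in> contract_edges K v E" "v \<notin> e"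
  shows "e \<in> E"
proof -
  obtain d where d: "d \<in> E" "e = contract_map K v ` d"
    using assms unfolding contract_edges_def by blast
  have "x \<notin> K" if "x \<in> d" for x
    using assms(2) d that by (force simp: contract_map_def)
  hence "e = d" using d by (auto simp: contract_map_def image_iff)
  thus ?thesis using d by simp
qed

text \<open>The contraction loses \<open>c\<close> vertices and at least the
  \<open>(c + 1) choose 2\<close> edges of \<open>K\<close>. A factor of the contraction arises from
  a factor of the original graph by dropping the clique \<open>K - {b}\<close> that covers
  \<open>v\<close>.\<close>

lemma tight_contract:
  assumes T: "tight_graph c (Suc q) V E" and "c \<ge> 3"
    and K: "v \<in> K" "K \<subseteq> V" "card K = c + 1" "two_subsets K \<subseteq> E"
    and cl: "\<And>u. {v, u} \<in> E \<Longrightarrow> u \<in> K"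
  shows "tight_graph c q (V - (K - {v})) (contract_edges K v E)"
    and "card (E - two_subsets K) + ((c + 1) choose 2) = card E"
proof -
  let ?f = "contract_map K v"
  let ?V = "V - (K - {v})"
  let ?E = "contract_edges K v E"
  have T': "finite V" "E \<subseteq> two_subsets V" "card V = Suc q * c + 1"
     "card E \<le> ((c + 1) choose 2) * Suc q" "\<forall>w\<in>V. \<exists>F. clique_factor c E F (V - {w})"
    using T by (auto simp: tight_graph_def)
  have finK: "finite K" using K T' finite_subset by blast
  have finE: "finite E" using T' finite_two_subsets finite_subset by metis
  have cK: "card (two_subsets K) = (c + 1) choose 2" using card_two_subsets finK K(3) by metis
  show ct: "card (E - two_subsets K) + ((c + 1) choose 2) = card E"
    using cK K(4) card_mono[OF finE K(4)] finite_two_subsets[OF finK] by (simp add: card_Diff_subset)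
  have "card ?E \<le> card (E - two_subsets K)"
    unfolding contract_edges_def using finE by (intro card_image_le) simp
  hence cE: "card ?E \<le> ((c + 1) choose 2) * q" using ct T'(4) by simp
  have "card ?V = card V - card (K - {v})" using K finK by (intro card_Diff_subset) auto
  hence cV: "card ?V = q * c + 1" using T'(3) K finK by simp
  have sub: "?E \<subseteq> two_subsets ?V"
  proof
    fix e assume "e \<in> ?E"
    then obtain d where d: "d \<in> E" "d \<notin> two_subsets K" "e = ?f ` d"
      unfolding contract_edges_def by blast
    then obtain a b where ab: "d = {a, b}" "a \<noteq> b" "a \<in> V" "b \<in> V"
      using T'(2) by (blast elim: two_subsetsE)
    have "\<not> (a \<in> K \<and> b \<in> K)" using d ab by (simp add: two_subsets_pair)
    hence "?f a \<noteq> ?f b" "?f a \<in> ?V" "?f b \<in> ?V"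
      using ab(2-4) K(1,2) by (auto simp: contract_map_def)
    thus "e \<in> two_subsets ?V" unfolding d(3) ab(1) by (simp add: two_subsets_pair del: Diff_iff)
  qed
  have fac: "\<exists>F. clique_factor c ?E F (?f ` (V - {w} - (K - {b})))"
    if F: "clique_factor c E F (V - {w})" and A: "K - {b} \<in> F" for F w b
  proof -
    have "clique_factor c E (F - {K - {b}}) (V - {w} - (K - {b}))"
      by (rule clique_factor_remove[OF F A])
    hence "clique_factor c ?E ((`) ?f ` (F - {K - {b}})) (?f ` (V - {w} - (K - {b})))"
    proof (rule clique_factor_image)
      \<comment> \<open>The only vertex of \<open>K\<close> that can remain is \<open>b\<close>, so
        neither vertices nor edge ends collide.\<close>
      show "inj_on ?f (V - {w} - (K - {b}))" using K(1)
        by (auto simp: inj_on_def contract_map_def)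
      show "{?f x, ?f y} \<in> ?E" if "{x, y} \<in> E" "x \<in> V - {w} - (K - {b})"
        "y \<in> V - {w} - (K - {b})" "x \<noteq> y" for x y
        using that by (intro contract_edges_pair) blast+
    qed
    thus ?thesis by blast
  qed
  have "\<exists>F. clique_factor c ?E F (?V - {w})" if w: "w \<in> ?V" for w
  proof (cases "w = v")
    \<comment> \<open>To delete \<open>v\<close> from the contraction, another vertex
      \<open>b\<close> of \<open>K\<close> is deleted from the original graph. The clique covering
      \<open>v\<close> is then \<open>K - {b}\<close>, and no vertex of \<open>K\<close> is left
      over.\<close>
    case True
    have "card (K - {v}) \<ge> 1" using K assms(2) by simp
    then obtain b where b: "b \<in> K - {v}" by (rule card_pos_obtain)
    then obtain F where F: "clique_factor c E F (V - {b})" using T'(5) K by blast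
    have "v \<in> V" "v \<noteq> b" using b K by auto
    then obtain A b' where A: "A \<in> F" "b' \<in> K" "A = K - {b'}"
      using factor_at_simplicial[OF F K(1) _ _ finK K(3) cl] by blast
    have "b \<notin> A" using F A(1) unfolding clique_factor_def by blast
    hence "b' = b" using A b by blast
    hence "\<exists>F. clique_factor c ?E F (?f ` (V - {b} - (K - {b})))" using fac[OF F] A by blast
    moreover have "?f ` (V - {b} - (K - {b})) = ?V - {w}"
      using True K b by (auto simp: contract_map_def image_iff)
    ultimately show ?thesis by simp
  next
    case False
    hence wK: "w \<notin> K" "w \<in> V" using w by auto
    then obtain F where F: "clique_factor c E F (V - {w})" using T'(5) by blast
    have "v \<in> V" "v \<noteq> w" using False K by auto
    then obtain A b where A: "A \<in> F" "b \<in> K" "A = K - {b}"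
      using factor_at_simplicial[OF F K(1) _ _ finK K(3) cl] by blast
    hence "\<exists>F. clique_factor c ?E F (?f ` (V - {w} - (K - {b})))" using fac[OF F] by blast
    \<comment> \<open>Here \<open>w\<close> lies outside \<open>K\<close>, so \<open>b\<close>
      survives the removal of \<open>K - {b}\<close> and takes the role of \<open>v\<close>.\<close>
    moreover have "?f ` (V - {w} - (K - {b})) = ?V - {w}"
    proof
      show "?f ` (V - {w} - (K - {b})) \<subseteq> ?V - {w}"
        using False K by (auto simp: contract_map_def)
      show "?V - {w} \<subseteq> ?f ` (V - {w} - (K - {b}))"
      proof
        fix x assume x: "x \<in> ?V - {w}"
        show "x \<in> ?f ` (V - {w} - (K - {b}))"
        proof (cases "x = v")
          case True
          thus ?thesis using A(2) K wK by (intro image_eqI[of _ _ b]) (auto simp: contract_map_def)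
        next
          case False
          thus ?thesis using x by (intro image_eqI[of _ _ x]) (auto simp: contract_map_def)
        qed
      qed
    qed
    ultimately show ?thesis by simp
  qed
  thus "tight_graph c q ?V ?E" using T'(1) sub cV cE unfolding tight_graph_def by blast
qed

text \<open>If \<open>x\<close> differs from \<open>v\<close>, the clique is untouched by the
  contraction. If \<open>x = v\<close>, tightness of the edge count lets each vertex of
  \<open>L\<close> have at most one neighbour in \<open>K\<close>, and fault tolerance forces all
  these neighbours to be one vertex, the new attaching vertex.\<close>

lemma pendant_uncontract:
  assumes T: "tight_graph c (Suc q) V E" and "c \<ge> 3"
    and K: "v \<in> K" "K \<subseteq> V" "card K = c + 1" "two_subsets K \<subseteq> E"
    and cl: "\<And>u. {v, u} \<in> E \<Longrightarrow> u \<in> K"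
    and card_eq: "card (contract_edges K v E) = ((c + 1) choose 2) * q"
    and P: "pendant_clique c (V - (K - {v})) (contract_edges K v E) L x" "v \<notin> L"
  shows "\<exists>y. pendant_clique c V E L y"
proof -
  let ?f = "contract_map K v"
  let ?E = "contract_edges K v E"
  have T': "finite V" "E \<subseteq> two_subsets V"
     "card E \<le> ((c + 1) choose 2) * Suc q" "\<forall>w\<in>V. \<exists>F. clique_factor c E F (V - {w})"
    using T by (auto simp: tight_graph_def)
  have finK: "finite K" using K T' finite_subset by blast
  have finE: "finite E" using T' finite_two_subsets finite_subset by metis
  have P': "L \<subseteq> V - (K - {v})" "x \<in> V - (K - {v})" "x \<notin> L" "card L = c"
    "two_subsets (insert x L) \<subseteq> ?E" "\<And>e. e \<in> ?E \<Longrightarrow> e \<inter> L \<noteq> {} \<Longrightarrow> e \<subseteq> insert x L"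
    using P(1) unfolding pendant_clique_def by auto
  have LK: "L \<inter> K = {}" "L \<subseteq> V" using P' P(2) by auto
  have finL: "finite L" using LK T' finite_subset by blast
  have LE: "two_subsets L \<subseteq> E"
  proof
    fix e assume e: "e \<in> two_subsets L"
    hence "e \<in> ?E" using P'(5) two_subsets_mono[of L "insert x L"] by blast
    moreover have "v \<notin> e" using e P(2) by (auto simp: two_subsets_def)
    ultimately show "e \<in> E" by (rule contract_edges_avoiding)
  qed
  have nbrL: "?f z \<in> insert x L" if "{y, z} \<in> E" "y \<in> L" for y z
  proof -
    have y: "?f y = y" "y \<notin> K" using that LK by (auto simp: contract_map_def)
    hence "{y, ?f z} \<in> ?E" using contract_edges_pair[OF that(1), of K v] by auto
    thus ?thesis using P'(6) that(2) by blast
  qed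
  show ?thesis
  proof (cases "x = v")
    case False
    hence xK: "x \<notin> K" using P' by blast
    have "two_subsets (insert x L) \<subseteq> E"
    proof
      fix e assume e: "e \<in> two_subsets (insert x L)"
      hence "e \<in> ?E" using P'(5) by blast
      moreover have "v \<notin> e" using e P(2) False by (auto simp: two_subsets_def)
      ultimately show "e \<in> E" by (rule contract_edges_avoiding)
    qed
    moreover have "e \<subseteq> insert x L" if e: "e \<in> E" "e \<inter> L \<noteq> {}" for e
    proof -
      obtain a b where "e = {a, b}" using e T' by (blast elim: two_subsetsE)
      then obtain y z where yz: "e = {y, z}" "y \<in> L" using e(2)
        by (metis Int_emptyI insert_commute insertE singletonD)
      hence "?f z \<in> insert x L" using nbrL e(1) by blast
      hence "z \<in> insert x L" using False P(2) by (auto simp: contract_map_def split: if_splits)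
      thus ?thesis using yz by blast
    qed
    ultimately have "pendant_clique c V E L x"
      unfolding pendant_clique_def using P' LK by blast
    thus ?thesis by blast
  next
    case True
    \<comment> \<open>The edge count is tight, so the contraction merges no two edges.\<close>
    have "card ?E = card (E - two_subsets K)"
      using tight_contract(2)[OF T assms(2) K cl] T'(3) card_eq
        card_image_le[of "E - two_subsets K" "(`) ?f"] finE
      by (fastforce simp: contract_edges_def)
    hence inj: "inj_on ((`) ?f) (E - two_subsets K)"
      unfolding contract_edges_def using finE by (intro eq_card_imp_inj_on) auto
    \<comment> \<open>Two edges from \<open>y\<close> to \<open>K\<close> would have the same image
      under the contraction.\<close>
    have uniq: "b = b'" if "{b, y} \<in> E" "{b', y} \<in> E" "b \<in> K" "b' \<in> K" "y \<in> L" for b b' y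
    proof -
      have "y \<notin> K" using that LK by blast
      hence "{b, y} \<in> E - two_subsets K" "{b', y} \<in> E - two_subsets K"
        using that by (auto simp: two_subsets_pair)
      moreover have "?f ` {b, y} = ?f ` {b', y}" using that by (simp add: contract_map_def)
      ultimately have "{b, y} = {b', y}" using inj by (meson inj_onD)
      thus ?thesis by (auto simp: doubleton_eq_iff)
    qed
    have nbrL': "z \<in> L \<union> K" if "{y, z} \<in> E" "y \<in> L" for y z
      using nbrL[OF that] True K(1) by (auto simp: contract_map_def split: if_splits)
    \<comment> \<open>After deleting \<open>w\<close>, the clique covering \<open>v\<close> is
      \<open>K - {b}\<close>. The clique through another vertex of \<open>L\<close> is confined to
      \<open>L - {w}\<close> together with \<open>b\<close>, which has exactly \<open>c\<close>
      elements, so it is all of that set.\<close>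
    have attach: "\<exists>b\<in>K. \<forall>y\<in>L - {w}. {b, y} \<in> E" if w: "w \<in> L" for w
    proof -
      obtain F where F: "clique_factor c E F (V - {w})" using T'(4) w LK by blast
      have "v \<in> V" "v \<noteq> w" using w P(2) K by auto
      then obtain A b where A: "A \<in> F" "b \<in> K" "A = K - {b}"
        using factor_at_simplicial[OF F K(1) _ _ finK K(3) cl] by blast
      have "card (L - {w}) \<ge> 1" using w P'(4) assms(2) by simp
      then obtain y where y: "y \<in> L - {w}" by (rule card_pos_obtain)
      hence "y \<in> V - {w}" using LK by blast
      then obtain B where B: "B \<in> F" "y \<in> B" "B \<subseteq> V - {w}" "card B = c" "two_subsets B \<subseteq> E"
        by (rule clique_factor_cover[OF F])
      have "B \<subseteq> L \<union> K" using nbrL' y by (intro clique_subset_closed[OF B(5,2)]) auto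
      moreover have "B \<noteq> A" using A B(2) y LK by blast
      hence "A \<inter> B = {}" using clique_factor_disjoint[OF F A(1) B(1)] by blast
      ultimately have "B \<subseteq> insert b (L - {w})" using A B(3) by blast
      moreover have "b \<notin> L" using A LK by blast
      hence "card (insert b (L - {w})) = c" using w finL P'(4) assms(2) by simp
      ultimately have "B = insert b (L - {w})" using B(4) finL by (intro card_subset_eq) auto
      hence "\<forall>y\<in>L - {w}. {b, y} \<in> E" using clique_edge[OF B(5)] \<open>b \<notin> L\<close>
        by blast
      thus ?thesis using A by blast
    qed
    have "card L \<ge> 1" using P'(4) assms(2) by simp
    then obtain w0 where w0: "w0 \<in> L" by (rule card_pos_obtain)
    have "card (L - {w0}) \<ge> 1" using w0 P'(4) assms(2) by simp
    then obtain w1 where w1: "w1 \<in> L - {w0}" by (rule card_pos_obtain)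
    \<comment> \<open>As \<open>c \<ge> 3\<close>, a third vertex \<open>y\<close> of
      \<open>L\<close> remains. It is adjacent to the attaching vertices found by deleting
      \<open>w0\<close> and by deleting \<open>w1\<close>, so by \<open>uniq\<close> they
      agree.\<close>
    have "card (L - {w0, w1}) \<ge> 1" using w0 w1 P'(4) assms(2) finL
      by (auto simp: card_Diff_subset card_insert_if)
    then obtain y where y: "y \<in> L - {w0, w1}" by (rule card_pos_obtain)
    obtain b where b: "b \<in> K" "\<forall>y\<in>L - {w0}. {b, y} \<in> E" using attach w0 by blast
    obtain b' where b': "b' \<in> K" "\<forall>y\<in>L - {w1}. {b', y} \<in> E" using attach w1 by blast
    have "b = b'" using uniq[of b y b'] b b' y by blast
    hence bL: "{b, y} \<in> E" if "y \<in> L" for y using that b b' w0 w1 by (cases "y = w0") auto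
    have "two_subsets (insert b L) \<subseteq> E"
    proof
      fix e assume "e \<in> two_subsets (insert b L)"
      then obtain a d where ad: "e = {a, d}" "a \<noteq> d" "a \<in> insert b L" "d \<in> insert b L"
        by (rule two_subsetsE)
      show "e \<in> E"
      proof (cases "a = b \<or> d = b")
        case True
        thus ?thesis using ad bL by (metis insertE insert_commute)
      next
        case False
        hence "e \<in> two_subsets L" using ad by (auto simp: two_subsets_pair)
        thus ?thesis using LE by blast
      qed
    qed
    moreover have "e \<subseteq> insert b L" if e: "e \<in> E" "e \<inter> L \<noteq> {}" for e
    proof -
      obtain a d where "e = {a, d}" using e T' by (blast elim: two_subsetsE)
      then obtain y z where yz: "e = {y, z}" "y \<in> L" using e(2)
        by (metis Int_emptyI insert_commute insertE singletonD)
      hence "z \<in> L \<union> K" using nbrL' e(1) by blast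
      \<comment> \<open>Since \<open>y\<close> is already adjacent to \<open>b\<close>, a neighbour
        of \<open>y\<close> in \<open>K\<close> can only be \<open>b\<close>.\<close>
      moreover have "z = b" if "z \<in> K"
        using uniq[of z y b] that yz e(1) bL b by (simp add: insert_commute)
      ultimately show ?thesis using yz by blast
    qed
    moreover have "b \<in> V" "b \<notin> L" using b K LK by auto
    ultimately have "pendant_clique c V E L b"
      unfolding pendant_clique_def using P'(4) LK by blast
    thus ?thesis by blast
  qed
qed

section \<open>Removing pendant cliques\<close>

text \<open>Deleting a vertex \<open>w\<close> outside \<open>L\<close> leaves a factor in which
  \<open>L\<close> itself is one of the cliques, so dropping \<open>L\<close> gives a factor of the
  smaller graph.\<close>

lemma tight_remove_pendant:
  assumes T: "tight_graph c (Suc q) V E" and "c \<ge> 3" and P: "pendant_clique c V E L x"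
  shows "tight_graph c q (V - L) {e\<in>E. e \<inter> L = {}}"
    and "card E = card {e\<in>E. e \<inter> L = {}} + ((c + 1) choose 2)"
proof -
  let ?E = "{e\<in>E. e \<inter> L = {}}"
  have T': "finite V" "E \<subseteq> two_subsets V" "card V = Suc q * c + 1"
     "card E \<le> ((c + 1) choose 2) * Suc q" "\<forall>w\<in>V. \<exists>F. clique_factor c E F (V - {w})"
    using T by (auto simp: tight_graph_def)
  have P': "L \<subseteq> V" "x \<in> V" "x \<notin> L" "card L = c"
    "two_subsets (insert x L) \<subseteq> E" "\<And>e. e \<in> E \<Longrightarrow> e \<inter> L \<noteq> {} \<Longrightarrow> e \<subseteq> insert x L"
    using P unfolding pendant_clique_def by auto
  have finL: "finite L" using P' T' finite_subset by blast
  have finE: "finite E" using T' finite_two_subsets finite_subset by metis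
  \<comment> \<open>Only one end of such an edge can be \<open>x\<close>. Hence the edges lost are
    exactly those of the clique \<open>insert x L\<close>.\<close>
  have meet: "e \<inter> L \<noteq> {}" if "e \<in> two_subsets (insert x L)" for e
    using that by (auto elim!: two_subsetsE)
  have "E = ?E \<union> two_subsets (insert x L)"
    using P'(5,6) T'(2) by (auto simp: two_subsets_def)
  moreover have "?E \<inter> two_subsets (insert x L) = {}" using meet by blast
  ultimately have "card E = card ?E + card (two_subsets (insert x L))"
    using finE finite_two_subsets[of "insert x L"] finL
    by (metis (no_types, lifting) card_Un_disjoint finite_Un)
  thus ct: "card E = card ?E + ((c + 1) choose 2)"
    using card_two_subsets[of "insert x L"] finL P' by simp
  have cE: "card ?E \<le> ((c + 1) choose 2) * q" using ct T'(4) by simp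
  have cV: "card (V - L) = q * c + 1" using P' T' finL by (simp add: card_Diff_subset)
  have sub: "?E \<subseteq> two_subsets (V - L)" using T'(2) by (auto simp: two_subsets_def)
  have "\<exists>F. clique_factor c ?E F (V - L - {w})" if w: "w \<in> V - L" for w
  proof -
    obtain F where F: "clique_factor c E F (V - {w})" using T'(5) w by blast
    have inF: "A \<subseteq> insert x L" if "A \<in> F" "y \<in> A" "y \<in> L" for A y
    proof -
      have "two_subsets A \<subseteq> E" using F that unfolding clique_factor_def by blast
      thus ?thesis using that P'(6) by (intro clique_subset_closed[of A E y]) auto
    qed
    have "card L \<ge> 1" using P'(4) assms(2) by simp
    then obtain y where y: "y \<in> L" by (rule card_pos_obtain)
    hence "y \<in> V - {w}" using w P' by blast
    then obtain A where A: "A \<in> F" "y \<in> A" "A \<subseteq> V - {w}" "card A = c"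
      by (rule clique_factor_cover[OF F])
    have AL: "A \<subseteq> insert x L" using inF A y by blast
    \<comment> \<open>Otherwise two disjoint cliques with \<open>c\<close> vertices each would fit
      into the \<open>c + 1\<close> vertices of \<open>insert x L\<close>.\<close>
    have "L \<subseteq> A"
    proof (rule ccontr)
      assume "\<not> L \<subseteq> A"
      then obtain z where z: "z \<in> L" "z \<notin> A" by blast
      hence "z \<in> V - {w}" using w P' by blast
      then obtain B where B: "B \<in> F" "z \<in> B" "card B = c"
        by (rule clique_factor_cover[OF F])
      have "B \<subseteq> insert x L" using inF B z by blast
      moreover have "A \<inter> B = {}" using clique_factor_disjoint[OF F A(1) B(1)] B z by blast
      ultimately have "card (A \<union> B) \<le> card (insert x L)" "card (A \<union> B) = card A + card B"
        using AL finL
        by (auto intro!: card_mono card_Un_disjoint intro: finite_subset)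
      thus False using A B P' finL assms(2) by simp
    qed
    hence "L = A" using A P' AL finL by (intro card_subset_eq) (auto intro: finite_subset)
    hence "clique_factor c E (F - {L}) (V - {w} - L)" using clique_factor_remove[OF F] A by blast
    moreover have "V - {w} - L = V - L - {w}" by blast
    ultimately have F': "clique_factor c E (F - {L}) (V - L - {w})" by simp
    have "two_subsets A \<subseteq> ?E" if "A \<in> F - {L}" for A
    proof -
      have "A \<subseteq> V - L - {w}" "two_subsets A \<subseteq> E" using F' that unfolding clique_factor_def by blast+
      thus ?thesis unfolding two_subsets_def by blast
    qed
    hence "clique_factor c ?E (F - {L}) (V - L - {w})" using F' unfolding clique_factor_def by simp
    thus ?thesis ..
  qed
  thus "tight_graph c q (V - L) ?E" using T'(1) sub cV cE unfolding tight_graph_def by blast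
qed

text \<open>Being able to avoid a prescribed vertex \<open>k\<close> is what makes the induction through the
  contraction work, with \<open>k\<close> the contracted vertex.\<close>

lemma tight_structure:
  assumes "tight_graph c p V E" "c \<ge> 3"
  shows "card E = ((c + 1) choose 2) * p \<and>
    (p \<ge> 1 \<longrightarrow> (\<forall>k\<in>V. \<exists>L x. pendant_clique c V E L x \<and> k \<notin> L))"
  using assms(1)
proof (induction p arbitrary: V E)
  case 0
  thus ?case by (simp add: tight_graph_def)
next
  case (Suc q)
  note T = Suc.prems
  have fin: "finite V" "E \<subseteq> two_subsets V" "card V = Suc q * c + 1"
    using T by (auto simp: tight_graph_def)
  obtain v K where K: "v \<in> K" "K \<subseteq> V" "card K = c + 1" "two_subsets K \<subseteq> E"
    and cl: "\<And>u. {v, u} \<in> E \<Longrightarrow> u \<in> K"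
    using ex_simplicial_clique[OF T assms(2)] by auto
  \<comment> \<open>For \<open>q = 0\<close> the graph is the clique \<open>K\<close>, and
    \<open>k\<close> itself can be the attaching vertex. For \<open>q > 0\<close> the vertex avoided
    in the induction hypothesis has to be \<open>v\<close>, so nothing is claimed about
    \<open>k\<close> yet.\<close>
  have ex_pendant: "\<exists>L x. pendant_clique c V E L x \<and> (q = 0 \<longrightarrow> k \<notin> L)" if k: "k \<in> V" for k
  proof (cases "q = 0")
    case True
    hence "K = V" using K fin by (intro card_subset_eq) auto
    hence "insert k (V - {k}) = K" using k by blast
    hence "pendant_clique c V E (V - {k}) k"
      using K fin k True unfolding pendant_clique_def by (auto simp: two_subsets_def)
    thus ?thesis by blast
  next
    case False
    let ?V = "V - (K - {v})" and ?E = "contract_edges K v E"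
    have "v \<in> ?V" using K by blast
    moreover have "card ?E = ((c + 1) choose 2) * q"
      and "\<forall>k\<in>?V. \<exists>L x. pendant_clique c ?V ?E L x \<and> k \<notin> L"
      using Suc.IH[OF tight_contract(1)[OF T assms(2) K cl]] False by simp_all
    ultimately show ?thesis using pendant_uncontract[OF T assms(2) K cl] False by blast
  qed
  obtain L x where L: "pendant_clique c V E L x" using ex_pendant K by blast
  note R = tight_remove_pendant[OF T assms(2) L]
  note IH = Suc.IH[OF R(1)]
  have "card E = ((c + 1) choose 2) * Suc q" using R(2) IH by simp
  moreover have "\<exists>L x. pendant_clique c V E L x \<and> k \<notin> L" if k: "k \<in> V" for k
  proof (cases "q = 0 \<or> k \<notin> L")
    case True
    thus ?thesis using ex_pendant[OF k] L by blast
  next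
    case False
    have L': "L \<subseteq> V" "x \<in> V" "x \<notin> L" "\<And>e. e \<in> E \<Longrightarrow> e \<inter> L \<noteq> {} \<Longrightarrow> e \<subseteq> insert x L"
      using L unfolding pendant_clique_def by auto
    \<comment> \<open>Now \<open>k\<close> lies in \<open>L\<close>, and the vertex to avoid is
      \<open>x\<close>. Edges from \<open>L\<close> to the rest end in \<open>x\<close>, so a
      pendant clique of the smaller graph with \<open>x \<notin> M\<close> is still pendant in the
      whole graph.\<close>
    obtain M y where M: "pendant_clique c (V - L) {e\<in>E. e \<inter> L = {}} M y" "x \<notin> M"
      using IH False L' by fastforce
    have M': "M \<subseteq> V - L" "y \<in> V - L" "y \<notin> M" "card M = c" "two_subsets (insert y M) \<subseteq> E"
      "\<And>e. e \<in> E \<Longrightarrow> e \<inter> L = {} \<Longrightarrow> e \<inter> M \<noteq> {} \<Longrightarrow> e \<subseteq> insert y M"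
      using M(1) unfolding pendant_clique_def by auto
    have "e \<subseteq> insert y M" if e: "e \<in> E" "e \<inter> M \<noteq> {}" for e
    proof (rule M'(6)[OF e(1) _ e(2)])
      show "e \<inter> L = {}" using L'(4)[OF e(1)] e(2) M'(1) M(2) by blast
    qed
    hence "pendant_clique c V E M y" using M'(1-5) unfolding pendant_clique_def by auto
    moreover have "k \<notin> M" using M'(1) False by blast
    ultimately show ?thesis by blast
  qed
  ultimately show ?case by blast
qed

section \<open>Components, cutvertices and blocks\<close>

lemma reachable_complete:
  assumes "u \<in> K" "v \<in> K"
  shows "reachable (Graph K (two_subsets K)) u v"
proof (cases "u = v")
  case False
  thus ?thesis unfolding reachable_def
    using assms by (intro r_into_rtranclp) (simp add: two_subsets_pair)
qed (simp add: reachable_def)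

lemma components_complete:
  "components (Graph K (two_subsets K)) = (if K = {} then {} else {K})"
  using reachable_complete[of _ K] unfolding components_def by auto

text \<open>Deleting a vertex from a complete graph leaves a complete graph or the empty one, so the
  number of components does not grow.\<close>

lemma nonseparable_complete:
  assumes "finite K" "K \<noteq> {}" "K \<subseteq> V" "two_subsets K \<subseteq> E"
  shows "nonseparable_subgraph (Graph K (two_subsets K)) (Graph V E)"
proof -
  have "delete_verts (Graph K (two_subsets K)) {v} = Graph (K - {v}) (two_subsets (K - {v}))" for v
    by (auto simp: delete_verts_def two_subsets_def)
  hence "\<not> cutvertex (Graph K (two_subsets K)) v" for v
    using assms(2) unfolding cutvertex_def by (auto simp: components_complete)
  thus ?thesis using assms reachable_complete[of _ K]
    by (auto simp: nonseparable_subgraph_def subgraph_def simple_graph_def connected_graph_def)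
qed

text \<open>Otherwise \<open>x\<close> is a cutvertex of \<open>B\<close>: once it is deleted, no
  edge leads out of \<open>L\<close>, which separates a vertex in \<open>L\<close> from one outside
  \<open>insert x L\<close>.\<close>

lemma nonseparable_meets_pendant:
  assumes B: "nonseparable_subgraph B (Graph V E)" and P: "pendant_clique c V E L x"
    and meets: "verts B \<inter> L \<noteq> {}"
  shows "verts B \<subseteq> insert x L"
proof (rule ccontr)
  assume "\<not> ?thesis"
  then obtain z where z: "z \<in> verts B" "z \<notin> insert x L" by blast
  obtain y where y: "y \<in> verts B" "y \<in> L" using meets by blast
  have B': "finite (verts B)" "edges B \<subseteq> two_subsets (verts B)" "edges B \<subseteq> E"
    "\<And>u v. u \<in> verts B \<Longrightarrow> v \<in> verts B \<Longrightarrow> reachable B u v" "\<not> cutvertex B x"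
    using B by (auto simp: nonseparable_subgraph_def subgraph_def simple_graph_def connected_graph_def)
  have P': "x \<notin> L" "\<And>e. e \<in> E \<Longrightarrow> e \<inter> L \<noteq> {} \<Longrightarrow> e \<subseteq> insert x L"
    using P unfolding pendant_clique_def by auto
  let ?D = "delete_verts B {x}"
  have stay: "u \<in> L" if "reachable ?D y u" for u
    using that unfolding reachable_def
  proof (induction rule: rtranclp_induct)
    case (step u u')
    hence "{u, u'} \<in> E" "u' \<noteq> x" using B' by (auto simp: delete_verts_def)
    thus ?case using P'(2)[of "{u, u'}"] step.IH by auto
  qed (rule y)
  \<comment> \<open>If \<open>x\<close> were not in \<open>B\<close>, deleting it would change
    nothing and \<open>B\<close> would already be disconnected.\<close>
  have x: "x \<in> verts B"
  proof (rule ccontr)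
    assume "x \<notin> verts B"
    hence "?D = B" using B'(2) by (cases B) (auto simp: delete_verts_def two_subsets_def)
    thus False using stay[of z] B'(4)[OF y(1) z(1)] z by simp
  qed
  have yz: "y \<in> verts ?D" "z \<in> verts ?D" using y z P' by (auto simp: delete_verts_def)
  let ?C = "\<lambda>u. {v \<in> verts ?D. reachable ?D u v}"
  have "?C y \<in> components ?D" "?C z \<in> components ?D" using yz unfolding components_def by blast+
  moreover have "z \<in> ?C z" using yz by (simp add: reachable_def)
  hence "?C y \<noteq> ?C z" using stay z by blast
  moreover have "finite (components ?D)"
    using B'(1) unfolding components_def by (simp add: delete_verts_def)
  ultimately have "card (components ?D) \<ge> 2"
    using card_mono[of "components ?D" "{?C y, ?C z}"] by simp
  moreover have "components B = {verts B}" using B'(4) x unfolding components_def by blast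
  ultimately have "cutvertex B x" using x unfolding cutvertex_def by simp
  thus False using B'(5) by simp
qed

text \<open>A block inside \<open>insert x L\<close> is the whole clique by maximality. Any other
  block avoids \<open>L\<close> and is a block of the smaller graph, to which the induction
  applies.\<close>

lemma block_tight:
  assumes "tight_graph c p V E" "c \<ge> 3" "p \<ge> 1" "block B (Graph V E)"
  shows "\<exists>K. finite K \<and> card K = c + 1 \<and> B = Graph K (two_subsets K)"
  using assms(1,3,4)
proof (induction p arbitrary: V E)
  case (Suc q)
  note T = Suc.prems(1)
  have fin: "finite V" "card V = Suc q * c + 1" using T by (auto simp: tight_graph_def)
  then obtain k where "k \<in> V" using card_pos_obtain[of V] by auto
  then obtain L x where L: "pendant_clique c V E L x"
    using tight_structure[OF T assms(2)] by auto
  have L': "L \<subseteq> V" "x \<in> V" "x \<notin> L" "card L = c" "two_subsets (insert x L) \<subseteq> E"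
    using L unfolding pendant_clique_def by auto
  have finL: "finite L" using L' fin finite_subset by blast
  have NS: "nonseparable_subgraph B (Graph V E)"
    and mx: "\<And>B'. nonseparable_subgraph B' (Graph V E) \<Longrightarrow> subgraph B B' \<Longrightarrow> B' = B"
    using Suc.prems(3) unfolding block_def by auto
  have B: "simple_graph B" "verts B \<subseteq> V" "edges B \<subseteq> E" "edges B \<subseteq> two_subsets (verts B)"
    using NS by (auto simp: nonseparable_subgraph_def subgraph_def simple_graph_def)
  show ?case
  proof (cases "verts B \<subseteq> insert x L")
    case True
    let ?K = "Graph (insert x L) (two_subsets (insert x L))"
    have "nonseparable_subgraph ?K (Graph V E)" using L' finL by (intro nonseparable_complete) auto
    moreover have "subgraph B ?K"
      using B two_subsets_mono[OF True] True by (auto simp: subgraph_def)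
    ultimately have "B = ?K" using mx by blast
    thus ?thesis using finL L' by (intro exI[of _ "insert x L"]) simp
  next
    case False
    let ?E = "{e\<in>E. e \<inter> L = {}}"
    have BL: "verts B \<inter> L = {}" using nonseparable_meets_pendant[OF NS L] False by blast
    \<comment> \<open>The induction hypothesis needs \<open>q \<ge> 1\<close>; for
      \<open>q = 0\<close> the clique \<open>insert x L\<close> would be the whole graph.\<close>
    have "q \<noteq> 0"
    proof
      assume "q = 0"
      hence "insert x L = V" using fin L' finL by (intro card_subset_eq) auto
      thus False using False B by blast
    qed
    have sub: "subgraph B (Graph (V - L) ?E)" using B BL unfolding subgraph_def two_subsets_def
      by fastforce
    \<comment> \<open>Maximality is inherited, as every nonseparable subgraph of the smaller graph
      is one of the larger graph.\<close>
    have "block B (Graph (V - L) ?E)" unfolding block_def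
    proof (intro conjI allI impI)
      show "nonseparable_subgraph B (Graph (V - L) ?E)"
        using NS sub unfolding nonseparable_subgraph_def by blast
      fix B' assume "nonseparable_subgraph B' (Graph (V - L) ?E) \<and> subgraph B B'"
      thus "B' = B" by (intro mx) (auto simp: nonseparable_subgraph_def subgraph_def)
    qed
    thus ?thesis using Suc.IH[OF tight_remove_pendant(1)[OF T assms(2) L]] \<open>q \<noteq> 0\<close> by simp
  qed
qed simp

section \<open>From isomorphic copies to vertex sets, and the theorem\<close>

lemma complete_graph_iso:
  assumes "finite K" "card K = n"
  shows "graph_iso (Graph K (two_subsets K)) (complete_graph n)"
proof -
  obtain h where h: "bij_betw h K {0..<n}" using ex_bij_betw_finite_nat assms by blast
  hence "h u \<in> {..<n}" "h u = h v \<longleftrightarrow> u = v" if "u \<in> K" "v \<in> K" for u v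
    using that by (auto simp: bij_betw_def inj_on_eq_iff atLeast0LessThan)
  thus ?thesis using h unfolding graph_iso_def complete_graph_def
    by (intro exI[of _ h]) (auto simp: two_subsets_pair atLeast0LessThan)
qed

text \<open>Equal cardinalities make the embedded \<open>pK_c\<close> spanning, so the preimages of
  its copies partition the vertices of \<open>G\<close>.\<close>

lemma copies_complete_factor:
  assumes "finite (verts G)" "card (verts G) = p * c"
    and "contains_subgraph G (copies_complete p c)"
  shows "\<exists>F. clique_factor c (edges G) F (verts G)"
proof -
  obtain H f where H: "verts H \<subseteq> verts G" "edges H \<subseteq> edges G"
    and f: "bij_betw f (verts H) ({..<p} \<times> {..<c})"
    and adj: "\<And>u v. u \<in> verts H \<Longrightarrow> v \<in> verts H \<Longrightarrow>
      {u, v} \<in> edges H \<longleftrightarrow> {f u, f v} \<in> (\<Union>i<p. two_subsets ({i} \<times> {..<c}))"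
    using assms(3) unfolding contains_subgraph_def subgraph_def graph_iso_def copies_complete_def
    by auto
  have "card (verts H) = p * c" using bij_betw_same_card[OF f] by simp
  hence HG: "verts H = verts G" using H assms by (intro card_subset_eq) auto
  let ?A = "\<lambda>i. {u \<in> verts H. fst (f u) = i}"
  have fH: "f u \<in> {..<p} \<times> {..<c}" if "u \<in> verts H" for u using f that by (auto simp: bij_betw_def)
  have inj: "inj_on f (verts H)" using f by (simp add: bij_betw_def)
  have "\<Union>(?A ` {..<p}) = verts H" using fH by fastforce
  moreover have "pairwise disjnt (?A ` {..<p})" by (auto simp: pairwise_def disjnt_def)
  moreover have "card (?A i) = c \<and> two_subsets (?A i) \<subseteq> edges G" if i: "i < p" for i
  proof
    have "f ` ?A i = {i} \<times> {..<c}"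
    proof
      have "f u \<in> {i} \<times> {..<c}" if "u \<in> ?A i" for u using fH[of u] that by (auto simp: mem_Times_iff)
      thus "f ` ?A i \<subseteq> {i} \<times> {..<c}" by blast
      show "{i} \<times> {..<c} \<subseteq> f ` ?A i"
      proof
        fix t assume t: "t \<in> {i} \<times> {..<c}"
        hence "t \<in> f ` verts H" using f i unfolding bij_betw_def by auto
        then obtain u where u: "u \<in> verts H" "t = f u" by blast
        hence "u \<in> ?A i" using t by (simp add: mem_Times_iff)
        thus "t \<in> f ` ?A i" using u(2) by blast
      qed
    qed
    thus "card (?A i) = c"
      using card_image[OF inj_on_subset[OF inj, of "?A i"]] by auto
    show "two_subsets (?A i) \<subseteq> edges G"
    proof
      fix e assume "e \<in> two_subsets (?A i)"
      then obtain a b where ab: "e = {a, b}" "a \<noteq> b" "a \<in> ?A i" "b \<in> ?A i" by (rule two_subsetsE)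
      have "f a \<noteq> f b" using ab inj by (auto dest: inj_onD)
      hence "{f a, f b} \<in> two_subsets ({i} \<times> {..<c})"
        using ab fH by (auto simp: two_subsets_pair mem_Times_iff)
      hence "{a, b} \<in> edges H" using ab i adj by blast
      thus "e \<in> edges G" using ab H by blast
    qed
  qed
  ultimately have "clique_factor c (edges G) (?A ` {..<p}) (verts H)"
    unfolding clique_factor_def by auto
  thus ?thesis using HG by auto
qed

text \<open>Only faults consisting of a single vertex are needed: they leave exactly
  \<open>p * c\<close> vertices, which makes the \<open>p\<close> cliques a factor.\<close>

lemma fault_tolerant_tight:
  assumes "simple_graph G" "fault_tolerant 1 p c G" "card (verts G) = p * c + 1"
    and "card (edges G) \<le> ((c + 1) choose 2) * p"
  shows "tight_graph c p (verts G) (edges G)"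
proof -
  have "\<exists>F. clique_factor c (edges G) F (verts G - {w})" if w: "w \<in> verts G" for w
  proof -
    have "contains_subgraph (delete_verts G {w}) (copies_complete p c)"
      using assms(2) w unfolding fault_tolerant_def by simp
    moreover have "finite (verts (delete_verts G {w}))" "card (verts (delete_verts G {w})) = p * c"
      using assms(1,3) w by (auto simp: delete_verts_def simple_graph_def)
    ultimately obtain F where
      "clique_factor c (edges (delete_verts G {w})) F (verts (delete_verts G {w}))"
      using copies_complete_factor by blast
    hence "clique_factor c (edges G) F (verts G - {w})"
      unfolding clique_factor_def delete_verts_def by auto
    thus ?thesis by blast
  qed
  thus ?thesis using assms unfolding tight_graph_def simple_graph_def by blast
qed

theorem theorem1:
  fixes p c :: nat and G :: "'a graph"
  assumes "p \<ge> 1" and "c \<ge> 3"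
    and "simple_graph G"
    and "fault_tolerant 1 p c G"
    and "card (verts G) = p * c + 1"
    and "card (edges G) \<le> ((c + 1) choose 2) * p"
  shows "\<forall>B. block B G \<longrightarrow> graph_iso B (complete_graph (c + 1))"
proof (intro allI impI)
  fix B assume "block B G"
  hence "block B (Graph (verts G) (edges G))" by simp
  then obtain K where "finite K" "card K = c + 1" "B = Graph K (two_subsets K)"
    using block_tight[OF fault_tolerant_tight[OF assms(3-6)] assms(2,1)] by blast
  thus "graph_iso B (complete_graph (c + 1))" using complete_graph_iso by blast
qed

end
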